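(* Let $f(x)=a_0+a_1x+\cdots+a_mx^m$ be a polynomial over a commutative ring $R$ with $1$. Suppose that, under the assumption that $R\ne 0$, $R$ has an $n$-tuple $\{r_1,r_2,\dots,r_n\}$ of $f(x)$. (i) If $n>m$ and $1$ belongs to the ideal $(a_0,a_1,\dots,a_m)$ of $R$, then $R=0$. (ii) If $n\le m$ and $1$ belongs to the ideal of $R$ generated by the elements $$a_i-\frac{\det(\alpha_0,\dots,\alpha_{i-1},\beta,\alpha_{i+1},\dots,\alpha_{n-1})}{\det(\alpha_0,\alpha_1,\dots,\alpha_{n-1})},\qquad 0\le i\le n-1,$$ then $R=0$. Here $\alpha_i=(r_1^i,\dots,r_n^i)^T$ for $0\le i\le n-1$ and $\beta=\bigl(-\sum_{k=n}^m a_kr_1^k,\dots,-\sum_{k=n}^m a_kr_n^k\bigr)^T$.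
   Context: An $n$-tuple of $f(x)$ in $R$ is a subset $\{r_1,\dots,r_n\}$ of $R$ such that $f(r_i)=0$ for all $i$ and, for all $1\le i\ne j\le n$, $r_i-r_j$ is neither zero nor a zero-divisor in $R$. The hypothesis means: if $R\neq 0$, then such an $n$-tuple exists; the ideal conditions are to be read for this $n$-tuple under the assumption $R\ne0$. Meaning of fractions: if $d\in R$ is neither zero nor a zero-divisor, $t/d$ denotes the unique $t'\in R$ with $t=dt'$, when it exists. For an $n$-tuple of $f$ the determinant $\det(\alpha_0,\dots,\alpha_{n-1})$ is neither zero nor a zero-divisor, and it divides each numerator above. *)

theory Defs
  imports "HOL-Algebra.UnivPoly" "HOL-Combinatorics.Permutations"
begin

text \<open>
  The locale-based rings of \<^theory>\<open>HOL-Algebra.UnivPoly\<close> are used because the zero ring must be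
  allowed; it is excluded by the type class \<^class>\<open>comm_ring_1\<close>.
\<close>

definition zero_divisor :: "('a, 'b) ring_scheme \<Rightarrow> 'a \<Rightarrow> bool" where
  "zero_divisor R d \<longleftrightarrow>
     d \<in> carrier R \<and> (\<exists>x \<in> carrier R. x \<noteq> \<zero>\<^bsub>R\<^esub> \<and> d \<otimes>\<^bsub>R\<^esub> x = \<zero>\<^bsub>R\<^esub>)"

text \<open>
  The elements \<open>r\<^sub>1, \<dots>, r\<^sub>n\<close> are indexed from \<open>0\<close>, as \<open>r 0, \<dots>, r (n - 1)\<close>. They are
  pairwise distinct since their differences are nonzero.
\<close>

definition root_tuple :: "('a, 'b) ring_scheme \<Rightarrow> nat \<Rightarrow> (nat \<Rightarrow> 'a) \<Rightarrow> (nat \<Rightarrow> 'a) \<Rightarrow> bool" where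
  "root_tuple R n f r \<longleftrightarrow>
     (\<forall>i<n. r i \<in> carrier R \<and> eval R R id (r i) f = \<zero>\<^bsub>R\<^esub>) \<and>
     (\<forall>i<n. \<forall>j<n. i \<noteq> j \<longrightarrow>
        r i \<ominus>\<^bsub>R\<^esub> r j \<noteq> \<zero>\<^bsub>R\<^esub> \<and> \<not> zero_divisor R (r i \<ominus>\<^bsub>R\<^esub> r j))"

text \<open>
  Leibniz formula for the \<open>n \<times> n\<close> determinant with columns \<open>c 0, \<dots>, c (n - 1)\<close>; the entry of
  column \<open>j\<close> in row \<open>k\<close> is \<open>c j k\<close>.
\<close>

definition det_cols :: "('a, 'b) ring_scheme \<Rightarrow> nat \<Rightarrow> (nat \<Rightarrow> nat \<Rightarrow> 'a) \<Rightarrow> 'a" where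
  "det_cols R n c =
     (\<Oplus>\<^bsub>R\<^esub>p\<in>{p. p permutes {..<n}}.
        [sign p] \<cdot>\<^bsub>R\<^esub> (\<Otimes>\<^bsub>R\<^esub>k\<in>{..<n}. c (p k) k))"

text \<open>
  The quotient \<open>t / d\<close>; it is only meaningful if \<open>d\<close> is neither zero nor a zero-divisor
  and divides \<open>t\<close>.
\<close>

definition quot :: "('a, 'b) ring_scheme \<Rightarrow> 'a \<Rightarrow> 'a \<Rightarrow> 'a" where
  "quot R t d = (THE t'. t' \<in> carrier R \<and> t = d \<otimes>\<^bsub>R\<^esub> t')"

definition alpha_col :: "('a, 'b) ring_scheme \<Rightarrow> (nat \<Rightarrow> 'a) \<Rightarrow> nat \<Rightarrow> nat \<Rightarrow> 'a" where
  "alpha_col R r i = (\<lambda>j. r j [^]\<^bsub>R\<^esub> i)"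

definition beta_col ::
  "('a, 'b) ring_scheme \<Rightarrow> nat \<Rightarrow> nat \<Rightarrow> (nat \<Rightarrow> 'a) \<Rightarrow> (nat \<Rightarrow> 'a) \<Rightarrow> nat \<Rightarrow> 'a" where
  "beta_col R n m a r =
     (\<lambda>j. \<ominus>\<^bsub>R\<^esub> (\<Oplus>\<^bsub>R\<^esub>k\<in>{n..m}. a k \<otimes>\<^bsub>R\<^esub> r j [^]\<^bsub>R\<^esub> k))"

end

theory Submission
  imports Defs
begin

text \<open>
  The roots \<open>r 0, \<dots>, r (n - 1)\<close> turn the coefficients of \<open>f\<close> into the solution of a linear
  system whose matrix is the Vandermonde matrix of the roots, with columns \<open>\<alpha>\<^sub>0, \<dots>, \<alpha>\<^sub>n\<^sub>-\<^sub>1\<close>. Its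
  determinant \<open>D\<close> is the product of the differences \<open>r j - r l\<close> for \<open>l < j\<close>
  (lemma \<open>vandermonde\<close>), hence neither zero nor a zero-divisor when \<open>R\<close> is not the zero ring. By
  Cramer's rule (lemma \<open>cramer\<close>), the \<open>i\<close>-th unknown times \<open>D\<close> equals the determinant with the
  \<open>i\<close>-th column replaced by the right-hand side.

  If \<open>n > m\<close>, the coefficients, padded by zeros to length \<open>n\<close>, solve the homogeneous system, so all
  of them vanish. If \<open>n \<le> m\<close>, moving the terms of degree at least \<open>n\<close> to the right-hand side
  shows that \<open>a 0, \<dots>, a (n - 1)\<close> solve the system with right-hand side \<open>\<beta>\<close>, so the fraction in the
  \<open>i\<close>-th generator is \<open>a i\<close> itself. In both cases every generator of the ideal is zero; an ideal
  that is zero and contains \<open>1\<close> exists only in the zero ring.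

  Both facts about determinants rest on a single computation, that of a determinant in which one
  column is replaced by a linear combination of all columns. For the Vandermonde determinant it
  justifies replacing the monomials \<open>x\<^sup>j\<close> by the Newton polynomials
  \<open>(x - r 0) \<cdots> (x - r (j - 1))\<close>, which make the matrix triangular.
\<close>

section \<open>Regular elements\<close>

text \<open>
  In the zero ring \<open>0\<close> is regular; in any other ring the regular elements are those that are neither
  zero nor a zero-divisor. Counting \<open>0\<close> in the zero ring keeps the notion closed under all finite
  products, in every commutative ring.
\<close>

definition regular :: "('a, 'b) ring_scheme \<Rightarrow> 'a \<Rightarrow> bool" where
  "regular R d \<longleftrightarrow>
     d \<in> carrier R \<and> (\<forall>x \<in> carrier R. d \<otimes>\<^bsub>R\<^esub> x = \<zero>\<^bsub>R\<^esub> \<longrightarrow> x = \<zero>\<^bsub>R\<^esub>)"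

context cring
begin

lemma regular_finprod:
  assumes "finite A" and "\<And>i. i \<in> A \<Longrightarrow> regular R (g i)"
  shows "regular R (\<Otimes>i\<in>A. g i)"
  using assms
proof (induction A rule: finite_induct)
  case empty
  then show ?case by (simp add: regular_def)
next
  case (insert i A)
  have g: "g i \<in> carrier R" "g \<in> A \<rightarrow> carrier R"
    using insert.prems by (auto simp: regular_def)
  have "x = \<zero>" if x: "x \<in> carrier R" and eq: "g i \<otimes> finprod R g A \<otimes> x = \<zero>" for x
  proof -
    have "g i \<otimes> (finprod R g A \<otimes> x) = \<zero>"
      using eq x g by (simp add: m_assoc)
    then have "finprod R g A \<otimes> x = \<zero>"
      using insert.prems[of i] x g by (simp add: regular_def)
    then show ?thesis
      using insert.IH[OF insert.prems] x unfolding regular_def by blast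
  qed
  then show ?case
    using insert.hyps g by (simp add: regular_def)
qed

lemma quot_eqI:
  assumes "regular R d" and x: "x \<in> carrier R"
  shows "quot R (d \<otimes> x) d = x"
  unfolding quot_def
proof (rule the_equality)
  fix y assume y: "y \<in> carrier R \<and> d \<otimes> x = d \<otimes> y"
  have d: "d \<in> carrier R" using assms(1) by (simp add: regular_def)
  have "d \<otimes> (y \<ominus> x) = d \<otimes> y \<ominus> d \<otimes> x"
    using d x y by algebra
  also have "\<dots> = \<zero>" using d x y by simp algebra
  finally have "y \<ominus> x = \<zero>"
    using assms(1) minus_closed[of y x] x y unfolding regular_def by blast
  moreover have "y = (y \<ominus> x) \<oplus> x" using x y by algebra
  ultimately show "y = x" using x by simp
qed (use x in simp)

lemma finprod_zero:
  assumes "finite A" and "i \<in> A" and "g \<in> A \<rightarrow> carrier R" and "g i = \<zero>"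
  shows "(\<Otimes>k\<in>A. g k) = \<zero>"
proof -
  have "finprod R g (insert i (A - {i})) = g i \<otimes> finprod R g (A - {i})"
    using assms by (intro finprod_insert) auto
  moreover have "finprod R g (A - {i}) \<in> carrier R"
    using assms by (intro finprod_closed) auto
  ultimately show ?thesis
    using assms by (simp add: insert_absorb)
qed

section \<open>Determinants as alternating multilinear functions of the columns\<close>

lemma det_cols_term_closed:
  assumes "\<And>j k. j < n \<Longrightarrow> k < n \<Longrightarrow> c j k \<in> carrier R" and "p permutes {..<n}"
  shows "(\<Otimes>k\<in>{..<n}. c (p k) k) \<in> carrier R"
  using assms permutes_in_image[OF assms(2)] by (intro finprod_closed) auto

lemma det_cols_closed:
  assumes "\<And>j k. j < n \<Longrightarrow> k < n \<Longrightarrow> c j k \<in> carrier R"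
  shows "det_cols R n c \<in> carrier R"
  unfolding det_cols_def
  using det_cols_term_closed[of n c] assms by (intro finsum_closed) auto

lemma det_cols_cong:
  assumes "\<And>j k. j < n \<Longrightarrow> k < n \<Longrightarrow> c j k = d j k"
    and "\<And>j k. j < n \<Longrightarrow> k < n \<Longrightarrow> d j k \<in> carrier R"
  shows "det_cols R n c = det_cols R n d"
  unfolding det_cols_def
proof (rule finsum_cong')
  fix p assume "p \<in> {p. p permutes {..<n}}"
  then have p: "p permutes {..<n}" by simp
  have "(\<Otimes>k\<in>{..<n}. c (p k) k) = (\<Otimes>k\<in>{..<n}. d (p k) k)"
    using assms permutes_in_image[OF p] by (intro finprod_cong') auto
  then show "[sign p] \<cdot> (\<Otimes>k\<in>{..<n}. c (p k) k) = [sign p] \<cdot> (\<Otimes>k\<in>{..<n}. d (p k) k)"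
    by simp
qed (use det_cols_term_closed[of n d] assms(2) in auto)

text \<open>
  In the Leibniz product of \<open>p\<close>, column \<open>i\<close> is met exactly once, in row \<open>p\<^sup>-\<^sup>1(i)\<close>. Isolating that
  factor makes the dependence on the column visible: the other factors do not involve it. The inverse
  permutation is written with \<^const>\<open>inv_into\<close> because \<open>inv\<close> denotes the multiplicative inverse
  in \<open>R\<close> here.
\<close>

lemma det_cols_expand_column:
  assumes c: "\<And>j k. j < n \<Longrightarrow> k < n \<Longrightarrow> c j k \<in> carrier R"
    and v: "\<And>k. k < n \<Longrightarrow> v k \<in> carrier R" and i: "i < n"
  shows "det_cols R n (c(i := v)) =
    (\<Oplus>p\<in>{p. p permutes {..<n}}.
       v (inv_into UNIV p i) \<otimes> ([sign p] \<cdot> (\<Otimes>k\<in>{..<n} - {inv_into UNIV p i}. c (p k) k)))"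
  unfolding det_cols_def
proof (rule finsum_cong')
  fix p assume "p \<in> {p. p permutes {..<n}}"
  then have p: "p permutes {..<n}" by simp
  define q where "q = inv_into UNIV p i"
  have q: "q < n" "p q = i"
    using permutes_in_image[OF permutes_inv[OF p], of i] i permutes_inverses(1)[OF p]
    by (auto simp: q_def)
  have ne: "p k \<noteq> i" if "k \<noteq> q" for k
    using that permutes_inj[OF p] q(2) by (auto dest: injD)
  have pk: "p k < n" if "k < n" for k using permutes_in_image[OF p, of k] that by simp
  have "(\<Otimes>k\<in>insert q ({..<n} - {q}). (c(i := v)) (p k) k)
      = (c(i := v)) (p q) q \<otimes> (\<Otimes>k\<in>{..<n} - {q}. (c(i := v)) (p k) k)"
    using c v q ne pk by (intro finprod_insert) auto
  also have "(\<Otimes>k\<in>{..<n} - {q}. (c(i := v)) (p k) k) = (\<Otimes>k\<in>{..<n} - {q}. c (p k) k)"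
    using c ne pk by (intro finprod_cong') auto
  finally have "(\<Otimes>k\<in>{..<n}. (c(i := v)) (p k) k) = v q \<otimes> (\<Otimes>k\<in>{..<n} - {q}. c (p k) k)"
    using q by (simp add: insert_absorb)
  moreover have "(\<Otimes>k\<in>{..<n} - {q}. c (p k) k) \<in> carrier R"
    using c pk by (intro finprod_closed) auto
  ultimately show "[sign p] \<cdot> (\<Otimes>k\<in>{..<n}. (c(i := v)) (p k) k) =
      v (inv_into UNIV p i) \<otimes> ([sign p] \<cdot> (\<Otimes>k\<in>{..<n} - {inv_into UNIV p i}. c (p k) k))"
    using add_pow_rdistr_int[of "v q"] v q by (simp flip: q_def)
next
  have "v (inv_into UNIV p i) \<otimes> ([sign p] \<cdot> (\<Otimes>k\<in>{..<n} - {inv_into UNIV p i}. c (p k) k)) \<in> carrier R"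
    if p: "p permutes {..<n}" for p
    using permutes_in_image[OF permutes_inv[OF p], of i] i c v permutes_in_image[OF p]
    by (intro m_closed add.int_pow_closed finprod_closed) auto
  then show "(\<lambda>p. v (inv_into UNIV p i) \<otimes> ([sign p] \<cdot> (\<Otimes>k\<in>{..<n} - {inv_into UNIV p i}. c (p k) k)))
      \<in> {p. p permutes {..<n}} \<rightarrow> carrier R"
    by auto
qed simp

lemma det_cols_linear:
  assumes c: "\<And>j k. j < n \<Longrightarrow> k < n \<Longrightarrow> c j k \<in> carrier R"
    and u: "\<And>k. k < n \<Longrightarrow> u k \<in> carrier R" and w: "\<And>k. k < n \<Longrightarrow> w k \<in> carrier R"
    and x: "x \<in> carrier R" and i: "i < n"
  shows "det_cols R n (c(i := \<lambda>k. x \<otimes> u k \<oplus> w k)) =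
    x \<otimes> det_cols R n (c(i := u)) \<oplus> det_cols R n (c(i := w))"
proof -
  define P where "P = {p. p permutes {..<n}}"
  define C where "C p = [sign p] \<cdot> (\<Otimes>k\<in>{..<n} - {inv_into UNIV p i}. c (p k) k)" for p
  have C: "C p \<in> carrier R" and q: "inv_into UNIV p i < n" if "p \<in> P" for p
  proof -
    have p: "p permutes {..<n}" using that by (simp add: P_def)
    show "C p \<in> carrier R"
      unfolding C_def using c permutes_in_image[OF p]
      by (intro add.int_pow_closed finprod_closed) auto
    show "inv_into UNIV p i < n"
      using permutes_in_image[OF permutes_inv[OF p], of i] i by simp
  qed
  have fin: "finite P" by (simp add: P_def finite_permutations)
  have expand: "det_cols R n (c(i := v)) = (\<Oplus>p\<in>P. v (inv_into UNIV p i) \<otimes> C p)"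
    if "\<And>k. k < n \<Longrightarrow> v k \<in> carrier R" for v
    unfolding P_def C_def using c that i by (rule det_cols_expand_column)
  have "det_cols R n (c(i := \<lambda>k. x \<otimes> u k \<oplus> w k)) =
      (\<Oplus>p\<in>P. (x \<otimes> u (inv_into UNIV p i) \<oplus> w (inv_into UNIV p i)) \<otimes> C p)"
    using u w x by (intro expand) simp
  also have "\<dots> = (\<Oplus>p\<in>P. x \<otimes> (u (inv_into UNIV p i) \<otimes> C p) \<oplus> w (inv_into UNIV p i) \<otimes> C p)"
    using u w x C q by (intro finsum_cong') (auto simp: l_distr m_assoc)
  also have "\<dots> = (\<Oplus>p\<in>P. x \<otimes> (u (inv_into UNIV p i) \<otimes> C p)) \<oplus> (\<Oplus>p\<in>P. w (inv_into UNIV p i) \<otimes> C p)"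
    using u w x C q by (intro finsum_addf) auto
  also have "(\<Oplus>p\<in>P. x \<otimes> (u (inv_into UNIV p i) \<otimes> C p)) = x \<otimes> (\<Oplus>p\<in>P. u (inv_into UNIV p i) \<otimes> C p)"
    using u x C q fin by (intro finsum_rdistr[symmetric]) auto
  finally show ?thesis
    using expand[of u] expand[of w] u w by presburger
qed

lemma det_cols_zero_column:
  assumes c: "\<And>j k. j < n \<Longrightarrow> k < n \<Longrightarrow> c j k \<in> carrier R"
    and i: "i < n" and z: "\<And>k. k < n \<Longrightarrow> c i k = \<zero>"
  shows "det_cols R n c = \<zero>"
proof -
  have "(\<Otimes>k\<in>{..<n}. c (p k) k) = \<zero>" if p: "p permutes {..<n}" for p
  proof (rule finprod_zero)
    show "inv_into UNIV p i \<in> {..<n}"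
      using permutes_in_image[OF permutes_inv[OF p], of i] i by simp
    then show "c (p (inv_into UNIV p i)) (inv_into UNIV p i) = \<zero>"
      using z permutes_inverses(1)[OF p] by simp
  qed (use c permutes_in_image[OF p] in auto)
  then show ?thesis
    unfolding det_cols_def by (intro add.finprod_one_eqI) simp
qed

lemma det_cols_combination:
  assumes c: "\<And>j k. j < n \<Longrightarrow> k < n \<Longrightarrow> c j k \<in> carrier R"
    and i: "i < n" and "finite A"
    and "\<And>l. l \<in> A \<Longrightarrow> x l \<in> carrier R"
    and "\<And>l k. l \<in> A \<Longrightarrow> k < n \<Longrightarrow> u l k \<in> carrier R"
  shows "det_cols R n (c(i := \<lambda>k. \<Oplus>l\<in>A. x l \<otimes> u l k)) =
    (\<Oplus>l\<in>A. x l \<otimes> det_cols R n (c(i := u l)))"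
  using assms(3-)
proof (induction A rule: finite_induct)
  case empty
  show ?case
    using c i by (simp, intro det_cols_zero_column[OF _ i]) auto
next
  case (insert a A)
  have D: "det_cols R n (c(i := u l)) \<in> carrier R" if "l \<in> insert a A" for l
    using c insert.prems that by (intro det_cols_closed) auto
  have "det_cols R n (c(i := \<lambda>k. \<Oplus>l\<in>insert a A. x l \<otimes> u l k)) =
      det_cols R n (c(i := \<lambda>k. x a \<otimes> u a k \<oplus> (\<Oplus>l\<in>A. x l \<otimes> u l k)))"
    using c insert by (intro det_cols_cong) (auto simp: Pi_def intro!: finsum_insert add.m_closed finsum_closed)
  also have "\<dots> = x a \<otimes> det_cols R n (c(i := u a)) \<oplus>
      det_cols R n (c(i := \<lambda>k. \<Oplus>l\<in>A. x l \<otimes> u l k))"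
    using c i insert.prems by (intro det_cols_linear) (auto intro!: finsum_closed)
  also have "\<dots> = (\<Oplus>l\<in>insert a A. x l \<otimes> det_cols R n (c(i := u l)))"
  proof -
    have "det_cols R n (c(i := \<lambda>k. \<Oplus>l\<in>A. x l \<otimes> u l k)) =
        (\<Oplus>l\<in>A. x l \<otimes> det_cols R n (c(i := u l)))"
      using insert.prems by (intro insert.IH) auto
    moreover have "(\<Oplus>l\<in>insert a A. x l \<otimes> det_cols R n (c(i := u l))) =
        x a \<otimes> det_cols R n (c(i := u a)) \<oplus> (\<Oplus>l\<in>A. x l \<otimes> det_cols R n (c(i := u l)))"
      using insert.hyps insert.prems(1) D by (intro finsum_insert) auto
    ultimately show ?thesis by presburger
  qed
  finally show ?case .
qed

text \<open>
  Composing with the transposition of \<open>i\<close> and \<open>l\<close> pairs the even permutations with the odd ones.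
  Paired permutations have the same product and opposite signs. The explicit pairing is used because
  \<open>det = - det\<close> would not suffice when \<open>2\<close> is a zero-divisor.
\<close>

lemma det_cols_equal_columns:
  assumes c: "\<And>j k. j < n \<Longrightarrow> k < n \<Longrightarrow> c j k \<in> carrier R"
    and il: "i < n" "l < n" "i \<noteq> l" and eq: "\<And>k. k < n \<Longrightarrow> c i k = c l k"
  shows "det_cols R n c = \<zero>"
proof -
  define t where "t p = (\<Otimes>k\<in>{..<n}. c (p k) k)" for p
  define E where "E = {p. p permutes {..<n} \<and> evenperm p}"
  define s where "s p = transpose i l \<circ> p" for p :: "nat \<Rightarrow> nat"
  have tr: "transpose i l permutes {..<n}"
    using il by (intro permutes_swap_id) auto
  have s_perm: "s p permutes {..<n}" if "p permutes {..<n}" for p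
    unfolding s_def using that tr by (rule permutes_compose)
  have s_even: "evenperm (s p) \<longleftrightarrow> \<not> evenperm p" if "p permutes {..<n}" for p
    unfolding s_def using that tr il(3) permutes_imp_permutation[of "{..<n}"]
    by (subst evenperm_comp) (auto simp: evenperm_swap)
  have s_s: "s (s p) = p" for p by (simp add: s_def fun_eq_iff)
  have split: "{p. p permutes {..<n}} = E \<union> s ` E"
  proof (intro equalityI subsetI)
    fix p assume "p \<in> {p. p permutes {..<n}}"
    then have p: "p permutes {..<n}" by simp
    show "p \<in> E \<union> s ` E"
    proof (cases "evenperm p")
      case False
      then have "s p \<in> E" using s_perm[OF p] s_even[OF p] by (simp add: E_def)
      then show ?thesis using s_s[of p] by (metis UnI2 imageI)
    qed (simp add: E_def p)
  qed (auto simp: E_def s_perm)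
  have disj: "E \<inter> s ` E = {}" by (auto simp: E_def s_even)
  have fin: "finite E" using finite_permutations[of "{..<n}"] by (simp add: E_def)
  have inj: "inj_on s E" by (metis inj_onI s_s)
  have t_cl: "t p \<in> carrier R" if "p permutes {..<n}" for p
    unfolding t_def using c that by (rule det_cols_term_closed)
  have t_s: "t (s p) = t p" if p: "p permutes {..<n}" for p
    unfolding t_def s_def using c eq il permutes_in_image[OF p]
    by (intro finprod_cong') (auto simp: transpose_def)
  have term_cl: "[sign p] \<cdot> t p \<in> carrier R" if "p permutes {..<n}" for p
    using t_cl[OF that] by simp
  have neg: "[(- 1 :: int)] \<cdot> y = \<ominus> y" if "y \<in> carrier R" for y
    using that by (simp add: add_pow_int_lt)
  have "det_cols R n c = (\<Oplus>p\<in>E. [sign p] \<cdot> t p) \<oplus> (\<Oplus>p\<in>s ` E. [sign p] \<cdot> t p)"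
    unfolding det_cols_def t_def[symmetric] split
    using fin disj term_cl s_perm by (intro finsum_Un_disjoint) (auto simp: E_def)
  also have "(\<Oplus>p\<in>s ` E. [sign p] \<cdot> t p) = (\<Oplus>p\<in>E. [sign (s p)] \<cdot> t (s p))"
    using inj term_cl s_perm by (intro finsum_reindex) (auto simp: E_def)
  also have "(\<Oplus>p\<in>E. [sign p] \<cdot> t p) \<oplus> \<dots> =
      (\<Oplus>p\<in>E. [sign p] \<cdot> t p \<oplus> [sign (s p)] \<cdot> t (s p))"
    using term_cl s_perm by (intro finsum_addf[symmetric]) (auto simp: E_def)
  also have "\<dots> = \<zero>"
    using t_cl by (intro add.finprod_one_eqI) (auto simp: E_def sign_def s_even t_s neg r_neg)
  finally show ?thesis .
qed

text \<open>
  Expanding column \<open>i\<close> linearly, the \<open>l\<close>-th summand with \<open>l \<noteq> i\<close> has column \<open>c l\<close> twice, so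
  only \<open>l = i\<close> survives. With \<open>x i = \<one>\<close> the lemma also says that adding multiples of other columns
  does not change the determinant.
\<close>

lemma cramer:
  assumes c: "\<And>j k. j < n \<Longrightarrow> k < n \<Longrightarrow> c j k \<in> carrier R"
    and i: "i < n" and x: "\<And>l. l < n \<Longrightarrow> x l \<in> carrier R"
  shows "det_cols R n (c(i := \<lambda>k. \<Oplus>l\<in>{..<n}. x l \<otimes> c l k)) = x i \<otimes> det_cols R n c"
proof -
  have "det_cols R n (c(i := \<lambda>k. \<Oplus>l\<in>{..<n}. x l \<otimes> c l k)) =
      (\<Oplus>l\<in>{..<n}. x l \<otimes> det_cols R n (c(i := c l)))"
    using c i x by (intro det_cols_combination) auto
  also have "\<dots> = (\<Oplus>l\<in>{..<n}. if i = l then x l \<otimes> det_cols R n c else \<zero>)"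
  proof (rule finsum_cong')
    fix l assume l: "l \<in> {..<n}"
    have "det_cols R n (c(i := c l)) = \<zero>" if "i \<noteq> l"
      using c i l that by (intro det_cols_equal_columns[of n _ i l]) auto
    then show "x l \<otimes> det_cols R n (c(i := c l)) =
        (if i = l then x l \<otimes> det_cols R n c else \<zero>)"
      using l x by auto
  qed (use x det_cols_closed[of n c] c in auto)
  also have "\<dots> = x i \<otimes> det_cols R n c"
    using i x det_cols_closed[of n c] c by (intro finsum_singleton) auto
  finally show ?thesis .
qed

text \<open>
  A permutation other than the identity moves some index \<open>k\<close> upwards, and the factor in row \<open>k\<close> of
  its product is zero.
\<close>

lemma det_cols_triangular:
  assumes c: "\<And>j k. j < n \<Longrightarrow> k < n \<Longrightarrow> c j k \<in> carrier R"
    and z: "\<And>j k. j < n \<Longrightarrow> k < j \<Longrightarrow> c j k = \<zero>"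
  shows "det_cols R n c = (\<Otimes>j\<in>{..<n}. c j j)"
proof -
  have diag: "(\<Otimes>j\<in>{..<n}. c j j) \<in> carrier R" using c by (intro finprod_closed) auto
  have "det_cols R n c =
      (\<Oplus>p\<in>{p. p permutes {..<n}}. if id = p then (\<Otimes>j\<in>{..<n}. c j j) else \<zero>)"
    unfolding det_cols_def
  proof (rule finsum_cong')
    fix p assume "p \<in> {p. p permutes {..<n}}"
    then have p: "p permutes {..<n}" by simp
    have "(\<Otimes>k\<in>{..<n}. c (p k) k) = \<zero>" if ne: "p \<noteq> id"
    proof -
      obtain k where k: "k < n" "k < p k"
        using permutes_natset_le[OF p] ne by (metis lessThan_iff not_le)
      show ?thesis
        using c z k permutes_in_image[OF p] by (intro finprod_zero[of _ k]) auto
    qed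
    then show "[sign p] \<cdot> (\<Otimes>k\<in>{..<n}. c (p k) k) =
        (if id = p then (\<Otimes>j\<in>{..<n}. c j j) else \<zero>)"
      using diag by auto
  qed (use diag in auto)
  also have "\<dots> = (\<Otimes>j\<in>{..<n}. c j j)"
    using diag by (intro finsum_singleton) (auto simp: finite_permutations permutes_id)
  finally show ?thesis .
qed

section \<open>The Vandermonde determinant\<close>

text \<open>
  The Newton polynomials are monic, with coefficients independent of the point \<open>x\<close>. Requiring
  \<open>d\<close> to vanish beyond degree \<open>j\<close> lets the sum be extended to any longer range.
\<close>

lemma newton_product_coeffs:
  fixes j :: nat
  assumes r: "\<And>l. l < j \<Longrightarrow> r l \<in> carrier R"
  shows "\<exists>d. (\<forall>l. d l \<in> carrier R) \<and> d j = \<one> \<and> (\<forall>l>j. d l = \<zero>) \<and>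
    (\<forall>x\<in>carrier R. (\<Otimes>l\<in>{..<j}. x \<ominus> r l) = (\<Oplus>l\<in>{..j}. d l \<otimes> x [^] l))"
  using r
proof (induction j)
  case 0
  show ?case by (rule exI[of _ "\<lambda>l. if l = 0 then \<one> else \<zero>"]) simp
next
  case (Suc j)
  then obtain d where d: "\<And>l. d l \<in> carrier R" "d j = \<one>" "\<And>l. j < l \<Longrightarrow> d l = \<zero>"
    and prod: "\<And>x. x \<in> carrier R \<Longrightarrow>
      (\<Otimes>l\<in>{..<j}. x \<ominus> r l) = (\<Oplus>l\<in>{..j}. d l \<otimes> x [^] l)"
    by (metis less_Suc_eq)
  have rj: "r j \<in> carrier R" using Suc.prems by simp
  (* Multiplying by x - r j shifts the coefficients up by one (this is b) and
     subtracts r j times the old ones. *)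
  define b where "b l = (case l of 0 \<Rightarrow> \<zero> | Suc l' \<Rightarrow> d l')" for l
  have b: "b l \<in> carrier R" for l using d by (simp add: b_def split: nat.split)
  have "(\<Otimes>l\<in>{..<Suc j}. x \<ominus> r l) = (\<Oplus>l\<in>{..Suc j}. (b l \<ominus> r j \<otimes> d l) \<otimes> x [^] l)"
    if x: "x \<in> carrier R" for x
  proof -
    define S where "S = (\<Oplus>l\<in>{..j}. d l \<otimes> x [^] l)"
    have S: "S \<in> carrier R" unfolding S_def using d x by (intro finsum_closed) auto
    have "(\<Otimes>l\<in>{..<Suc j}. x \<ominus> r l) = (x \<ominus> r j) \<otimes> S"
      unfolding lessThan_Suc S_def prod[OF x, symmetric] using Suc.prems x
      by (intro finprod_insert) auto
    also have "\<dots> = S \<otimes> x \<oplus> (\<ominus> r j) \<otimes> S"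
      using S x rj by algebra
    also have "S \<otimes> x = (\<Oplus>l\<in>{..j}. d l \<otimes> x [^] l \<otimes> x)"
      unfolding S_def using d x by (intro finsum_ldistr) auto
    also have "\<dots> = (\<Oplus>l\<in>{..j}. b (Suc l) \<otimes> x [^] Suc l)"
      using d x by (intro finsum_cong') (auto simp: b_def m_assoc)
    also have "\<dots> = (\<Oplus>l\<in>{..Suc j}. b l \<otimes> x [^] l)"
      using b x by (subst finsum_Suc2) (auto simp: b_def[of 0] simp del: nat_pow_Suc)
    also have "S = (\<Oplus>l\<in>{..Suc j}. d l \<otimes> x [^] l)"
      unfolding S_def using d x by (subst finsum_Suc) auto
    also have "(\<ominus> r j) \<otimes> \<dots> = (\<Oplus>l\<in>{..Suc j}. (\<ominus> r j) \<otimes> (d l \<otimes> x [^] l))"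
      using d x rj by (intro finsum_rdistr) auto
    also have "(\<Oplus>l\<in>{..Suc j}. b l \<otimes> x [^] l) \<oplus> \<dots> =
        (\<Oplus>l\<in>{..Suc j}. b l \<otimes> x [^] l \<oplus> (\<ominus> r j) \<otimes> (d l \<otimes> x [^] l))"
      using b d x rj by (intro finsum_addf[symmetric]) auto
    also have "\<dots> = (\<Oplus>l\<in>{..Suc j}. (b l \<ominus> r j \<otimes> d l) \<otimes> x [^] l)"
    proof (rule finsum_cong')
      fix l
      have "b l \<in> carrier R" "d l \<in> carrier R" "x [^] l \<in> carrier R" using b d x by auto
      then show "b l \<otimes> x [^] l \<oplus> (\<ominus> r j) \<otimes> (d l \<otimes> x [^] l) = (b l \<ominus> r j \<otimes> d l) \<otimes> x [^] l"
        using rj by algebra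
    qed (use b d x rj in auto)
    finally show ?thesis .
  qed
  moreover have "b (Suc j) \<ominus> r j \<otimes> d (Suc j) = \<one>"
    using d rj by (simp add: b_def minus_eq)
  moreover have "b l \<ominus> r j \<otimes> d l = \<zero>" if "Suc j < l" for l
    using d rj that by (auto simp: b_def minus_eq split: nat.split)
  ultimately show ?case
    using b d rj by (intro exI[of _ "\<lambda>l. b l \<ominus> r j \<otimes> d l"]) auto
qed

text \<open>
  Column \<open>j\<close> of powers is exchanged, one column at a time, for the values \<open>N j k\<close> of the \<open>j\<close>-th Newton
  polynomial at \<open>r k\<close>. Since that polynomial is monic of degree \<open>j\<close>, the exchange only adds
  multiples of the lower power columns. In the end the matrix is triangular, as the \<open>j\<close>-th Newton
  polynomial vanishes at \<open>r k\<close> for \<open>k < j\<close>.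
\<close>

lemma vandermonde:
  assumes r: "\<And>j. j < n \<Longrightarrow> r j \<in> carrier R"
  shows "det_cols R n (alpha_col R r) = (\<Otimes>j\<in>{..<n}. \<Otimes>l\<in>{..<j}. r j \<ominus> r l)"
proof -
  define N where "N j k = (\<Otimes>l\<in>{..<j}. r k \<ominus> r l)" for j k
  (* M t still has powers in the columns below t. Passing from M (Suc t) to M t exchanges
     column t, when all lower columns are still powers. *)
  define M where "M t j = (if j < t then alpha_col R r j else N j)" for t j
  have N: "N j k \<in> carrier R" if "j < n" "k < n" for j k
    unfolding N_def using r that by (intro finprod_closed) auto
  have alpha: "alpha_col R r j k \<in> carrier R" if "k < n" for j k
    using r that by (simp add: alpha_col_def)
  have M: "M t j k \<in> carrier R" if "j < n" "k < n" for t j k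
    using N alpha that by (simp add: M_def)
  have step: "det_cols R n (M t) = det_cols R n (M (Suc t))" if t: "t < n" for t
  proof -
    obtain d where d: "\<And>l. d l \<in> carrier R" "d t = \<one>" "\<And>l. t < l \<Longrightarrow> d l = \<zero>"
      and prod: "\<And>x. x \<in> carrier R \<Longrightarrow>
        (\<Otimes>l\<in>{..<t}. x \<ominus> r l) = (\<Oplus>l\<in>{..t}. d l \<otimes> x [^] l)"
      using newton_product_coeffs[of t r] r less_trans[OF _ t] by blast
    have "M t t k = (\<Oplus>l\<in>{..<n}. d l \<otimes> M (Suc t) l k)" if k: "k < n" for k
    proof -
      have "M t t k = (\<Oplus>l\<in>{..t}. d l \<otimes> r k [^] l)"
        using prod[OF r[OF k]] by (simp add: M_def N_def)
      also have "\<dots> = (\<Oplus>l\<in>{..<n}. d l \<otimes> M (Suc t) l k)"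
        using t d M N k by (intro add.finprod_mono_neutral_cong_left) (auto simp: M_def alpha_col_def)
      finally show ?thesis .
    qed
    then have "det_cols R n (M t) =
        det_cols R n ((M (Suc t))(t := \<lambda>k. \<Oplus>l\<in>{..<n}. d l \<otimes> M (Suc t) l k))"
      using M N alpha d by (intro det_cols_cong) (auto simp: M_def less_Suc_eq intro!: finsum_closed)
    also have "\<dots> = d t \<otimes> det_cols R n (M (Suc t))"
      using M d t by (intro cramer) auto
    also have "\<dots> = det_cols R n (M (Suc t))"
      using d det_cols_closed[of n "M (Suc t)"] M by simp
    finally show ?thesis .
  qed
  have "det_cols R n (M 0) = det_cols R n (M t)" if "t \<le> n" for t
    using that by (induction t) (auto simp: step)
  moreover have "M 0 = N" by (simp add: M_def fun_eq_iff)
  ultimately have "det_cols R n (M n) = det_cols R n N" by (metis order_refl)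
  also have "det_cols R n (M n) = det_cols R n (alpha_col R r)"
    using alpha by (intro det_cols_cong) (auto simp: M_def)
  also have "det_cols R n N = (\<Otimes>j\<in>{..<n}. N j j)"
  proof (rule det_cols_triangular)
    show "N j k = \<zero>" if "j < n" "k < j" for j k
      unfolding N_def using that r by (intro finprod_zero[of _ k]) (auto simp: minus_eq r_neg)
  qed (rule N)
  finally show ?thesis by (simp add: N_def)
qed

section \<open>From roots to coefficients\<close>

text \<open>
  The constant \<^const>\<open>eval\<close> sums up to the degree, which may be smaller than \<open>m\<close>. That evaluation at
  \<open>s\<close> is a ring homomorphism avoids any discussion of the degree.
\<close>

lemma eval_finsum_monom:
  assumes a: "\<And>i. i \<le> m \<Longrightarrow> a i \<in> carrier R" and s: "s \<in> carrier R"
  shows "eval R R id s (\<Oplus>\<^bsub>UP R\<^esub>i\<in>{..m::nat}. monom (UP R) (a i) i) = (\<Oplus>i\<in>{..m}. a i \<otimes> s [^] i)"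
proof -
  have up: "UP_pre_univ_prop R R id"
    by (rule UP_pre_univ_propI) (auto intro: is_cring simp: ring_hom_def)
  have ev: "ring_hom_cring (UP R) R (eval R R id s)"
    using UP_cring.UP_cring[of R] UP_pre_univ_prop.eval_ring_hom[OF up s] is_cring
    by (intro ring_hom_cringI) (auto simp: UP_cring_def)
  have mon: "monom (UP R) (a i) i \<in> carrier (UP R)" if "i \<le> m" for i
    using UP_ring.monom_closed[of R "a i" i] a that ring_axioms by (simp add: UP_ring_def)
  have "eval R R id s (\<Oplus>\<^bsub>UP R\<^esub>i\<in>{..m}. monom (UP R) (a i) i) =
      (\<Oplus>i\<in>{..m}. (eval R R id s \<circ> (\<lambda>i. monom (UP R) (a i) i)) i)"
    using mon by (intro ring_hom_cring.hom_finsum[OF ev]) auto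
  also have "\<dots> = (\<Oplus>i\<in>{..m}. a i \<otimes> s [^] i)"
    using a s UP_pre_univ_prop.eval_monom[OF up] by (intro finsum_cong') auto
  finally show ?thesis .
qed

lemma regular_vandermonde:
  assumes "root_tuple R n f r"
  shows "regular R (det_cols R n (alpha_col R r))"
proof -
  have r: "r j \<in> carrier R" if "j < n" for j
    using assms that by (simp add: root_tuple_def)
  have "regular R (r j \<ominus> r l)" if "j < n" "l < j" for j l
  proof -
    have "\<not> zero_divisor R (r j \<ominus> r l)"
      using assms that unfolding root_tuple_def by (metis less_trans nat_neq_iff)
    then show ?thesis
      using r that unfolding regular_def zero_divisor_def by auto
  qed
  then show ?thesis
    using r by (auto simp: vandermonde intro!: regular_finprod)
qed

lemma zero_ring_if_one_in_Idl:
  assumes "\<one> \<in> Idl S" and "S \<subseteq> {\<zero>}"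
  shows "carrier R = {\<zero>}"
proof -
  have "Idl S \<subseteq> {\<zero>}"
    using zeroideal assms(2) by (rule genideal_minimal)
  then have "\<one> = \<zero>" using assms(1) by blast
  then show ?thesis by (simp add: carrier_one_zero)
qed

end

theorem corollary1p10:
  fixes R (structure)
    and n m :: nat
    and a r :: "nat \<Rightarrow> 'a"
    and f :: "nat \<Rightarrow> 'a"
  assumes "cring (R :: ('a, 'b) ring_scheme)"
    and "\<And>i. i \<le> m \<Longrightarrow> a i \<in> carrier R"
    and "f = (\<Oplus>\<^bsub>UP R\<^esub>i\<in>{..m}. monom (UP R) (a i) i)"
    and "carrier R \<noteq> {\<zero>} \<Longrightarrow> root_tuple R n f r"
  shows "(n > m \<and> (carrier R \<noteq> {\<zero>} \<longrightarrow> \<one> \<in> Idl (a ` {..m})) \<longrightarrow> carrier R = {\<zero>}) \<and>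
    (n \<le> m \<and>
       (carrier R \<noteq> {\<zero>} \<longrightarrow>
          \<one> \<in> Idl ((\<lambda>i. a i \<ominus>
                 quot R (det_cols R n ((alpha_col R r)(i := beta_col R n m a r)))
                        (det_cols R n (alpha_col R r))) ` {..<n}))
     \<longrightarrow> carrier R = {\<zero>})"
proof (cases "carrier R = {\<zero>}")
  case False
  interpret cring R by fact
  let ?D = "det_cols R n (alpha_col R r)"
  note a = assms(2)
  have tuple: "root_tuple R n f r" using assms(4) False .
  have reg: "regular R ?D" using tuple by (rule regular_vandermonde)
  have D: "?D \<in> carrier R" using reg by (simp add: regular_def)
  have r: "r k \<in> carrier R" if "k < n" for k
    using tuple that by (simp add: root_tuple_def)
  have alpha: "alpha_col R r j k \<in> carrier R" if "k < n" for j k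
    using r that by (simp add: alpha_col_def)
  have root: "(\<Oplus>i\<in>{..m}. a i \<otimes> r k [^] i) = \<zero>" if k: "k < n" for k
    using eval_finsum_monom[of m a "r k", OF a r[OF k]] tuple k assms(3) by (simp add: root_tuple_def)
  (* The zero-padded coefficients x lie in the kernel of the Vandermonde matrix. *)
  have i: "a ` {..m} \<subseteq> {\<zero>}" if nm: "m < n"
  proof -
    define x where "x l = (if l \<le> m then a l else \<zero>)" for l
    have x: "x l \<in> carrier R" for l using a by (simp add: x_def)
    have "x i = \<zero>" if i: "i < n" for i
    proof -
      have comb: "(\<Oplus>l\<in>{..<n}. x l \<otimes> alpha_col R r l k) = \<zero>" if k: "k < n" for k
      proof -
        have "(\<Oplus>l\<in>{..m}. a l \<otimes> r k [^] l) = (\<Oplus>l\<in>{..<n}. x l \<otimes> alpha_col R r l k)"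
          using nm x r[OF k]
          by (intro add.finprod_mono_neutral_cong_left) (auto simp: x_def alpha_col_def)
        then show ?thesis using root[OF k] by simp
      qed
      have "x i \<otimes> ?D =
          det_cols R n ((alpha_col R r)(i := \<lambda>k. \<Oplus>l\<in>{..<n}. x l \<otimes> alpha_col R r l k))"
        using alpha i x by (intro cramer[symmetric]) auto
      also have "\<dots> = \<zero>"
        using alpha i comb by (intro det_cols_zero_column[of n _ i]) auto
      finally have "?D \<otimes> x i = \<zero>" using x D by (simp add: m_comm)
      then show ?thesis using reg x by (simp add: regular_def)
    qed
    then have "a i = \<zero>" if "i \<le> m" for i
      using nm that by (metis le_less_trans x_def)
    then show ?thesis by auto
  qed
  (* The low coefficients solve the system with right-hand side beta. *)
  have ii: "a i \<ominus> quot R (det_cols R n ((alpha_col R r)(i := beta_col R n m a r))) ?D = \<zero>"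
    if nm: "n \<le> m" and i: "i < n" for i
  proof -
    have beta: "beta_col R n m a r k = (\<Oplus>l\<in>{..<n}. a l \<otimes> alpha_col R r l k)"
      if k: "k < n" for k
    proof -
      let ?t = "\<lambda>l. a l \<otimes> r k [^] l"
      have t: "?t \<in> {..<n} \<rightarrow> carrier R" "?t \<in> {n..m} \<rightarrow> carrier R"
        using a nm r[OF k] by auto
      have "{..m} = {..<n} \<union> {n..m}" using nm by auto
      then have "\<zero> = (\<Oplus>l\<in>{..<n} \<union> {n..m}. ?t l)" using root[OF k] by simp
      also have "\<dots> = (\<Oplus>l\<in>{..<n}. ?t l) \<oplus> (\<Oplus>l\<in>{n..m}. ?t l)"
        using t by (intro finsum_Un_disjoint) auto
      finally have "\<ominus> (\<Oplus>l\<in>{n..m}. ?t l) = (\<Oplus>l\<in>{..<n}. ?t l)"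
        using t by (intro minus_equality) auto
      then show ?thesis by (simp add: beta_col_def alpha_col_def)
    qed
    have "det_cols R n ((alpha_col R r)(i := beta_col R n m a r)) =
        det_cols R n ((alpha_col R r)(i := \<lambda>k. \<Oplus>l\<in>{..<n}. a l \<otimes> alpha_col R r l k))"
      using beta alpha a nm by (intro det_cols_cong) (auto intro!: finsum_closed)
    also have "\<dots> = a i \<otimes> ?D"
      using alpha a nm i by (intro cramer) auto
    also have "\<dots> = ?D \<otimes> a i"
      using a nm i D by (simp add: m_comm)
    finally show ?thesis
      using quot_eqI[OF reg, of "a i"] a nm i by (simp add: minus_eq r_neg)
  qed
  show ?thesis
    using zero_ring_if_one_in_Idl[OF _ i] False
      zero_ring_if_one_in_Idl[of "(\<lambda>i. a i \<ominus>
         quot R (det_cols R n ((alpha_col R r)(i := beta_col R n m a r))) ?D) ` {..<n}"] ii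
    by (auto simp: image_subset_iff)
qed simp

end
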